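(* Let $N\ge1$, $c=(c_1,\dots,c_N)\in\mathbb{R}^N$, let $l>0$, and let $u_{01},\dots,u_{0N}$ be real constants. Let $u_j^\nu(x,t)$, $j=1,\dots,N$, be the solution, given by the explicit formula in the context, of $$(u_j)_t+\Big(\sum_{k=1}^N c_ku_k\Big)(u_j)_x=\frac{\nu}{2}(u_j)_{xx},\qquad \nu>0,$$ with initial data $$u_j(x,0)=\begin{cases}0,& x<-l\\ u_{0j},& -l<x<l\\ 0,& x>l.\end{cases}$$ Let $\sigma_0=\sum_{k=1}^N c_ku_{0k}$. Then for every $j=1,\dots,N$ the limit $u_j(x,t)=\lim_{\nu\to0}u_j^\nu(x,t)$ exists and takes the following form at the points $(x,t)$, $t>0$, of the indicated regions. When $\sigma_0=0$: $$u_j(x,t)=\begin{cases}0,&\text{if } x<-l\\ u_{0j},&\text{if } -l<x<l\\ 0,&\text{if } x>l.\end{cases}$$ When $\sigma_0<0$: $$u_j(x,t)=\begin{cases}0,&\text{if } x<\frac{\sigma_0}{2}t-l,\ t<\frac{-4l}{\sigma_0}\\[2pt] u_{0j},&\text{if } \frac{\sigma_0}{2}t-l<x<\sigma_0t+l,\ t<\frac{-4l}{\sigma_0}\\[2pt] \frac{u_{0j}}{\sigma_0}\cdot\frac{x-l}{t},&\text{if } \sigma_0t+l<x<l,\ t<\frac{-4l}{\sigma_0}\\[2pt] 0,&\text{if } x<l-(-4l\sigma_0t)^{1/2},\ t>\frac{-4l}{\sigma_0}\\[2pt] \frac{u_{0j}}{\sigma_0}\cdot\frac{x-l}{t},&\text{if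 } l-(-4l\sigma_0t)^{1/2}<x<l,\ t>\frac{-4l}{\sigma_0}\\[2pt] 0,&\text{if } x>l.\end{cases}$$ When $\sigma_0>0$: $$u_j(x,t)=\begin{cases}0,&\text{if } x>\frac{\sigma_0}{2}t+l,\ t<\frac{4l}{\sigma_0}\\[2pt] u_{0j},&\text{if } \sigma_0t-l<x<\frac{\sigma_0}{2}t+l,\ t<\frac{4l}{\sigma_0}\\[2pt] \frac{u_{0j}}{\sigma_0}\cdot\frac{x+l}{t},&\text{if } -l<x<\sigma_0t-l,\ t<\frac{4l}{\sigma_0}\\[2pt] 0,&\text{if } x>-l+(4l\sigma_0t)^{1/2},\ t>\frac{4l}{\sigma_0}\\[2pt] \frac{u_{0j}}{\sigma_0}\cdot\frac{x+l}{t},&\text{if } -l<x<-l+(4l\sigma_0t)^{1/2},\ t>\frac{4l}{\sigma_0}\\[2pt] 0,&\text{if } x<-l.\end{cases}$$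
   Context: The solution of the viscous system $(u_j)_t+\big(\sum_k c_ku_k\big)(u_j)_x=\frac{\nu}{2}(u_j)_{xx}$ with initial data $u_j(x,0)$ always means the one given, for $x\in\mathbb{R}$ and $t>0$, by the (generalized Hopf--Cole) explicit formula $$u_j^\nu(x,t)=\frac{\int_{-\infty}^{\infty}u_{j}(y,0)\,e^{-\frac1\nu\left[I(y)+\frac{(x-y)^2}{2t}\right]}\,dy}{\int_{-\infty}^{\infty}e^{-\frac1\nu\left[I(y)+\frac{(x-y)^2}{2t}\right]}\,dy},\qquad I(y)=\int_0^y\sum_{k=1}^N c_ku_k(z,0)\,dz.$$ *)

theory Defs
  imports "HOL-Analysis.Analysis"
begin

text \<open>
  A family of initial data is a function \<open>v :: nat \<Rightarrow> real \<Rightarrow> real\<close>, where \<open>v j y\<close> is the value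
  \<open>u\<^sub>j(y,0)\<close> and only the components \<open>j \<in> {1..N}\<close> are relevant.
\<close>

text \<open>\<open>I(y)\<close>: the interval integral is oriented, so \<open>I(y) = - \<integral>\<^sub>y\<^sup>0 \<dots>\<close> for \<open>y < 0\<close>.\<close>

definition potential :: "nat \<Rightarrow> (nat \<Rightarrow> real) \<Rightarrow> (nat \<Rightarrow> real \<Rightarrow> real) \<Rightarrow> real \<Rightarrow> real" where
  "potential N c v y = (LBINT z=ereal 0..ereal y. (\<Sum>k=1..N. c k * v k z))"

definition kernel ::
    "nat \<Rightarrow> (nat \<Rightarrow> real) \<Rightarrow> (nat \<Rightarrow> real \<Rightarrow> real) \<Rightarrow> real \<Rightarrow> real \<Rightarrow> real \<Rightarrow> real \<Rightarrow> real" where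
  "kernel N c v \<nu> x t y = exp (- (1 / \<nu>) * (potential N c v y + (x - y)\<^sup>2 / (2 * t)))"

text \<open>
  The generalized Hopf--Cole formula for the solution \<open>u\<^sub>j\<^sup>\<nu>(x,t)\<close> of
  \<open>(u\<^sub>j)\<^sub>t + (\<Sum>k. c\<^sub>k u\<^sub>k) (u\<^sub>j)\<^sub>x = (\<nu>/2) (u\<^sub>j)\<^sub>x\<^sub>x\<close> with initial data \<open>v\<close>;
  meaningful for \<open>\<nu> > 0\<close> and \<open>t > 0\<close>.
\<close>

definition viscous_solution ::
    "nat \<Rightarrow> (nat \<Rightarrow> real) \<Rightarrow> (nat \<Rightarrow> real \<Rightarrow> real) \<Rightarrow> real \<Rightarrow> nat \<Rightarrow> real \<Rightarrow> real \<Rightarrow> real" where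
  "viscous_solution N c v \<nu> j x t =
     (LINT y|lborel. v j y * kernel N c v \<nu> x t y) / (LINT y|lborel. kernel N c v \<nu> x t y)"

end

theory Submission
  imports Defs
begin

text \<open>
  Off the two points \<open>\<plusminus>l\<close>, which carry no Lebesgue mass, the data are \<open>u0 j\<close> times the indicator of
  \<open>(-l,l)\<close>. Hence every \<open>u\<^sub>j\<^sup>\<nu>(x,t)\<close> is \<open>u0 j\<close> times one and the same number: the fraction of the mass of
  \<open>exp (-F/\<nu>)\<close> that lies in \<open>(-l,l)\<close>, where \<open>F(y) = \<sigma> clamp(y) + (x - y)\<^sup>2/(2t)\<close>, \<open>\<sigma>\<close> is the initial
  speed \<open>\<sigma>\<^sub>0\<close> on \<open>(-l,l)\<close>, and \<open>clamp\<close> projects onto \<open>[-l,l]\<close> (\<open>viscous_solution_eq_mass_fraction\<close>). As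
  \<open>\<nu> \<rightarrow> 0\<close> the mass gathers where \<open>F\<close> is minimal, and the three possible kinds of value come from the
  position of that minimum.

  If some value of \<open>F\<close> lies a positive gap below all its values on \<open>(-l,l)\<close>, the fraction tends
  to 0 (\<open>laplace_avoids\<close>); if it lies such a gap below all values outside, the fraction tends to 1
  (\<open>laplace_concentrates\<close>). If \<open>F\<close> is minimal exactly at the endpoint \<open>l\<close>, it has a corner there, with
  slopes \<open>-a < 0\<close> and \<open>b > 0\<close> on the two sides. On the scale \<open>\<nu>\<close> the mass then looks like two
  exponential tails of masses proportional to \<open>1/a\<close> and \<open>1/b\<close>, of which only the left one lies in the
  interval, so the fraction tends to \<open>b/(a+b)\<close> (\<open>laplace_corner\<close>). Here \<open>b = (l - x)/t\<close> and
  \<open>a + b = -\<sigma>\<close>, which is the rarefaction fan.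

  For \<open>\<sigma> \<le> 0\<close> the only candidates for the minimum are \<open>x\<close> (when \<open>x\<close> lies outside the interval),
  \<open>x - \<sigma>t\<close> (when it lies inside) and \<open>l\<close>; at \<open>-l\<close> the slope of \<open>F\<close> jumps down, so that
  no minimum can occur there if \<open>\<sigma> < 0\<close>. Comparing the values of \<open>F\<close> at these candidates gives the regions: the
  line \<open>x = \<sigma>t/2 - l\<close> and the parabola \<open>(l - x)\<^sup>2 = -4l\<sigma>t\<close> are where two of these values tie.
  The case \<open>\<sigma> > 0\<close> is the mirror image under \<open>y \<mapsto> -y\<close> (\<open>mass_fraction_phase_reflect\<close>).
\<close>

section \<open>Laplace's method for mass fractions\<close>

definition mass_fraction :: "real set \<Rightarrow> (real \<Rightarrow> real) \<Rightarrow> real \<Rightarrow> real" where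
  "mass_fraction A F \<nu> =
     (LINT y|lborel. indicator A y * exp (- (1 / \<nu>) * F y)) / (LINT y|lborel. exp (- (1 / \<nu>) * F y))"

lemma tendsto_exp_minus_divide_at_right:
  fixes \<delta> :: real
  assumes "\<delta> > 0"
  shows "((\<lambda>\<nu>. exp (- (\<delta> / \<nu>))) \<longlongrightarrow> 0) (at_right 0)"
proof -
  have "filterlim (\<lambda>\<tau>::real. - (\<delta> * \<tau>)) at_bot at_top"
    using assms by (intro filterlim_compose[OF filterlim_uminus_at_bot_at_top]
        filterlim_tendsto_pos_mult_at_top[OF tendsto_const _ filterlim_ident])
  then show ?thesis
    unfolding filterlim_at_right_to_top
    by (simp add: divide_inverse filterlim_compose[OF exp_at_bot])
qed

text \<open>
  On \<open>A\<close> the weight is at most \<open>exp (-(1/\<nu> - 1)(F m + \<delta>)) exp (-F)\<close>, while near \<open>m\<close> it is at least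
  \<open>exp (-(F m + \<delta>/2)/\<nu>)\<close>. The quotient of the two masses is therefore of order \<open>exp (-\<delta>/(2\<nu>))\<close>.
\<close>

lemma laplace_avoids:
  fixes F :: "real \<Rightarrow> real"
  assumes A [measurable]: "A \<in> sets borel"
    and int: "\<And>\<nu>. \<nu> > 0 \<Longrightarrow> integrable lborel (\<lambda>y. exp (- (1 / \<nu>) * F y))"
    and cont: "isCont F m" and "\<delta> > 0" and gap: "\<And>y. y \<in> A \<Longrightarrow> F m + \<delta> \<le> F y"
  shows "(mass_fraction A F \<longlongrightarrow> 0) (at_right 0)"
proof -
  obtain r where "r > 0" and r: "\<And>y. \<bar>y - m\<bar> < r \<Longrightarrow> F y < F m + \<delta> / 2"
  proof -
    have "eventually (\<lambda>y. F y < F m + \<delta> / 2) (nhds m)"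
      using cont \<open>\<delta> > 0\<close> by (intro order_tendstoD(2)[of F "F m"]) (auto simp: continuous_at tendsto_at_iff_tendsto_nhds)
    then show thesis using that by (auto simp: eventually_nhds_metric dist_real_def)
  qed
  define C where "C = (LINT y|lborel. exp (- F y))"
  define K where "K = C / (2 * r) * exp (F m + \<delta>)"
  have "C \<ge> 0" unfolding C_def by simp
  have bounds: "0 \<le> mass_fraction A F \<nu> \<and> mass_fraction A F \<nu> \<le> K * exp (- (\<delta> / 2 / \<nu>))"
    if \<nu>: "0 < \<nu>" "\<nu> < 1" for \<nu>
  proof -
    let ?w = "\<lambda>y. exp (- (1 / \<nu>) * F y)"
    have intA: "integrable lborel (\<lambda>y. indicator A y * ?w y)"
      using integrable_mult_indicator[OF _ int[OF \<open>0 < \<nu>\<close>], of A] by simp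
    have "(LINT y|lborel. indicator A y * ?w y)
        \<le> (LINT y|lborel. exp (- (1 / \<nu> - 1) * (F m + \<delta>)) * exp (- F y))"
    proof (intro integral_mono intA)
      show "integrable lborel (\<lambda>y. exp (- (1 / \<nu> - 1) * (F m + \<delta>)) * exp (- F y))"
        using int[of 1] by simp
      fix y
      show "indicator A y * ?w y \<le> exp (- (1 / \<nu> - 1) * (F m + \<delta>)) * exp (- F y)"
      proof (cases "y \<in> A")
        case True
        have "(1 / \<nu> - 1) * (F m + \<delta>) \<le> (1 / \<nu> - 1) * F y"
          using gap[OF True] \<nu> by (intro mult_left_mono) (auto simp: field_simps)
        then show ?thesis using True by (simp add: exp_add[symmetric] algebra_simps)
      qed simp
    qed
    then have up: "(LINT y|lborel. indicator A y * ?w y) \<le> exp (- (1 / \<nu> - 1) * (F m + \<delta>)) * C"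
      by (simp add: C_def)
    have "(LINT y|lborel. exp (- (1 / \<nu>) * (F m + \<delta> / 2)) * indicator {m - r<..<m + r} y)
        \<le> (LINT y|lborel. ?w y)"
    proof (intro integral_mono int[OF \<open>0 < \<nu>\<close>])
      fix y
      show "exp (- (1 / \<nu>) * (F m + \<delta> / 2)) * indicator {m - r<..<m + r} y \<le> ?w y"
        using r[of y] \<nu> by (auto simp: indicator_def abs_less_iff divide_simps)
    qed (use \<open>r > 0\<close> in simp)
    then have low: "exp (- (1 / \<nu>) * (F m + \<delta> / 2)) * (2 * r) \<le> (LINT y|lborel. ?w y)"
      using \<open>r > 0\<close> by simp
    have nonneg: "0 \<le> (LINT y|lborel. indicator A y * ?w y)" by simp
    have pos: "0 < exp (- (1 / \<nu>) * (F m + \<delta> / 2)) * (2 * r)" using \<open>r > 0\<close> by simp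
    have "mass_fraction A F \<nu>
        \<le> exp (- (1 / \<nu> - 1) * (F m + \<delta>)) * C / (exp (- (1 / \<nu>) * (F m + \<delta> / 2)) * (2 * r))"
      unfolding mass_fraction_def by (intro frac_le up low pos) (use \<open>C \<ge> 0\<close> in simp)
    also have "\<dots> = C / (2 * r) * (exp (- (1 / \<nu> - 1) * (F m + \<delta>)) / exp (- (1 / \<nu>) * (F m + \<delta> / 2)))"
      by (simp add: ac_simps)
    also have "\<dots> = K * exp (- (\<delta> / 2 / \<nu>))"
      by (simp add: K_def exp_diff[symmetric] exp_add[symmetric] algebra_simps add_divide_distrib diff_divide_distrib)
    finally show ?thesis using nonneg by (simp add: mass_fraction_def)
  qed
  have ev: "\<forall>\<^sub>F \<nu> in at_right 0. (0::real) < \<nu> \<and> \<nu> < 1"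
    using eventually_at_right_less[of "0::real"] eventually_at_rightI[of 0 1 "\<lambda>\<nu>::real. \<nu> < 1"]
    by (auto simp: eventually_conj)
  show ?thesis
  proof (rule tendsto_sandwich)
    show "\<forall>\<^sub>F \<nu> in at_right 0. 0 \<le> mass_fraction A F \<nu>"
      "\<forall>\<^sub>F \<nu> in at_right 0. mass_fraction A F \<nu> \<le> K * exp (- (\<delta> / 2 / \<nu>))"
      using ev bounds by (auto elim!: eventually_mono)
    show "((\<lambda>\<nu>. K * exp (- (\<delta> / 2 / \<nu>))) \<longlongrightarrow> 0) (at_right 0)"
      using tendsto_mult_right_zero[OF tendsto_exp_minus_divide_at_right[of "\<delta> / 2"]] \<open>\<delta> > 0\<close> by simp
  qed simp
qed

text \<open>
  The point is that the total mass is positive, so that the quotient is not a division by zero.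
\<close>

lemma mass_fraction_Compl:
  assumes [measurable]: "A \<in> sets borel"
    and int: "integrable lborel (\<lambda>y. exp (- (1 / \<nu>) * F y))"
  shows "mass_fraction A F \<nu> = 1 - mass_fraction (- A) F \<nu>"
proof -
  let ?w = "\<lambda>y. exp (- (1 / \<nu>) * F y)"
  have pos: "0 < (LINT y|lborel. ?w y)"
  proof -
    have "(LINT y|lborel. ?w y) \<noteq> 0"
    proof
      assume "(LINT y|lborel. ?w y) = 0"
      then have "AE y in lborel. ?w y = 0"
        using integral_nonneg_eq_0_iff_AE[OF int] by simp
      then show False
        by (simp flip: trivial_limit_def add: ae_filter_eq_bot_iff)
    qed
    moreover have "0 \<le> (LINT y|lborel. ?w y)" by simp
    ultimately show ?thesis by linarith
  qed
  have "(LINT y|lborel. ?w y) = (LINT y|lborel. indicator A y * ?w y + indicator (- A) y * ?w y)"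
    by (intro Bochner_Integration.integral_cong) (auto simp: indicator_def)
  also have "\<dots> = (LINT y|lborel. indicator A y * ?w y) + (LINT y|lborel. indicator (- A) y * ?w y)"
    using integrable_mult_indicator[OF _ int, of A] integrable_mult_indicator[OF _ int, of "- A"]
    by (intro Bochner_Integration.integral_add) auto
  finally show ?thesis using pos by (simp add: mass_fraction_def field_simps)
qed

lemma laplace_concentrates:
  fixes F :: "real \<Rightarrow> real"
  assumes A [measurable]: "A \<in> sets borel"
    and int: "\<And>\<nu>. \<nu> > 0 \<Longrightarrow> integrable lborel (\<lambda>y. exp (- (1 / \<nu>) * F y))"
    and cont: "isCont F m" and "\<delta> > 0" and gap: "\<And>y. y \<notin> A \<Longrightarrow> F m + \<delta> \<le> F y"
  shows "(mass_fraction A F \<longlongrightarrow> 1) (at_right 0)"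
proof -
  have "(mass_fraction (- A) F \<longlongrightarrow> 0) (at_right 0)"
    using gap by (intro laplace_avoids[OF _ int cont \<open>\<delta> > 0\<close>]) auto
  then have "((\<lambda>\<nu>. 1 - mass_fraction (- A) F \<nu>) \<longlongrightarrow> 1 - 0) (at_right 0)"
    by (intro tendsto_intros)
  moreover have "\<forall>\<^sub>F \<nu> in at_right 0. 1 - mass_fraction (- A) F \<nu> = mass_fraction A F \<nu>"
    using eventually_at_right_less[of "0::real"]
    by eventually_elim (simp add: mass_fraction_Compl[OF A int])
  ultimately show ?thesis by (simp add: tendsto_cong)
qed

section \<open>Minima at a corner\<close>

lemma has_bochner_integral_exp_right:
  assumes "(k::real) > 0"
  shows "has_bochner_integral lborel (\<lambda>z. indicator {0..} z * exp (- k * z)) (1 / k)"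
proof (rule has_bochner_integral_nn_integral)
  show "(\<integral>\<^sup>+z. ennreal (indicator {0..} z * exp (- k * z)) \<partial>lborel) = ennreal (1 / k)"
    using has_integral_exp_minus_to_infinity[OF assms, of 0]
    by (intro nn_integral_has_integral_lebesgue) auto
qed (use assms in auto)

lemma has_bochner_integral_exp_left:
  assumes "(k::real) > 0"
  shows "has_bochner_integral lborel (\<lambda>z. indicator {..0} z * exp (k * z)) (1 / k)"
  using lborel_has_bochner_integral_real_affine_iff[of "-1" "\<lambda>z. indicator {0..} z * exp (- k * z)" "1/k" 0]
    has_bochner_integral_exp_right[OF assms]
  by (simp add: indicator_def of_bool_def)

lemma integrable_exp_abs:
  assumes "(k::real) > 0" shows "integrable lborel (\<lambda>z. exp (- k * \<bar>z\<bar>))"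
proof (rule Bochner_Integration.integrable_bound)
  show "integrable lborel (\<lambda>z. indicator {0..} z * exp (- k * z) + indicator {..0} z * exp (k * z))"
    using has_bochner_integral_exp_right[OF assms] has_bochner_integral_exp_left[OF assms]
    by (auto simp: has_bochner_integral_iff)
  show "AE z in lborel. norm (exp (- k * \<bar>z\<bar>))
      \<le> norm (indicator {0..} z * exp (- k * z) + indicator {..0} z * exp (k * z))"
    by (auto simp: indicator_def)
qed simp

text \<open>
  The substitution \<open>y = p + \<nu>z\<close> turns \<open>(F y - F p)/\<nu>\<close> into a function of \<open>z\<close> that tends to \<open>bz\<close> for
  \<open>z > 0\<close> and to \<open>-az\<close> for \<open>z < 0\<close>, and coercivity provides the majorant \<open>exp (-k\<bar>z\<bar>)\<close> for dominated
  convergence. The limiting masses are \<open>1/a\<close> to the left and \<open>1/b\<close> to the right of the corner. The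
  hypothesis \<open>coercive\<close> makes \<open>a\<close> and \<open>b\<close> positive.
\<close>

lemma laplace_corner:
  fixes F :: "real \<Rightarrow> real"
  assumes A [measurable]: "A \<in> sets borel" and F [measurable]: "F \<in> borel_measurable borel"
    and "k > 0" and coercive: "\<And>y. F p + k * \<bar>y - p\<bar> \<le> F y"
    and left: "(F has_real_derivative - a) (at_left p)"
    and right: "(F has_real_derivative b) (at_right p)"
    and A_left: "\<forall>\<^sub>F y in at_left p. y \<in> A" and A_right: "\<forall>\<^sub>F y in at_right p. y \<notin> A"
  shows "(mass_fraction A F \<longlongrightarrow> b / (a + b)) (at_right 0)"
proof -
  have "b \<ge> k"
  proof (rule tendsto_lowerbound)
    show "((\<lambda>y. (F y - F p) / (y - p)) \<longlongrightarrow> b) (at_right p)"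
      using right by (simp add: has_field_derivative_iff)
    show "\<forall>\<^sub>F y in at_right p. k \<le> (F y - F p) / (y - p)"
      using eventually_at_right_less[of p]
    proof eventually_elim
      case (elim y) with coercive[of y] show ?case by (simp add: field_simps)
    qed
  qed simp
  have "- a \<le> - k"
  proof (rule tendsto_upperbound)
    show "((\<lambda>y. (F y - F p) / (y - p)) \<longlongrightarrow> - a) (at_left p)"
      using left by (simp add: has_field_derivative_iff)
    show "\<forall>\<^sub>F y in at_left p. (F y - F p) / (y - p) \<le> - k"
      using eventually_at_left_real[of "p - 1" p, simplified]
    proof eventually_elim
      case (elim y) with coercive[of y] show ?case by (simp add: field_simps)
    qed
  qed simp
  have "a > 0" "b > 0" using \<open>b \<ge> k\<close> \<open>- a \<le> - k\<close> \<open>k > 0\<close> by auto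
  \<comment> \<open>The limit is taken along \<open>\<tau> = 1/\<nu> \<rightarrow> \<infinity>\<close>; the weight is normalised to be 1 at the corner.\<close>
  define g where "g = (\<lambda>\<tau> z. exp (- \<tau> * (F (p + inverse \<tau> * z) - F p)))"
  have g_meas [measurable]: "g \<tau> \<in> borel_measurable borel" for \<tau> unfolding g_def by measurable
  have g_bound: "g \<tau> z \<le> exp (- k * \<bar>z\<bar>)" if "\<tau> > 0" for \<tau> z
  proof -
    have "\<tau> * (k * \<bar>inverse \<tau> * z\<bar>) \<le> \<tau> * (F (p + inverse \<tau> * z) - F p)"
      using coercive[of "p + inverse \<tau> * z"] that by (intro mult_left_mono) auto
    moreover have "\<tau> * (k * \<bar>inverse \<tau> * z\<bar>) = k * \<bar>z\<bar>"
      using that by (simp add: abs_mult)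
    ultimately show ?thesis by (simp add: g_def)
  qed
  have shrink: "((\<lambda>\<tau>. p + inverse \<tau> * z) \<longlongrightarrow> p) at_top" for z
    using tendsto_add[OF tendsto_const tendsto_mult_left_zero[OF tendsto_inverse_0_at_top[OF filterlim_ident]], of p z]
    by simp
  have quot: "(F (p + inverse \<tau> * z) - F p) / (p + inverse \<tau> * z - p) * z
      = \<tau> * (F (p + inverse \<tau> * z) - F p)" if "z \<noteq> 0" for \<tau> z
    using that by (simp add: inverse_eq_divide)
  have lim_right: "((\<lambda>\<tau>. g \<tau> z) \<longlongrightarrow> exp (- b * z)) at_top"
      and ev_right: "\<forall>\<^sub>F \<tau> in at_top. p + inverse \<tau> * z \<notin> A" if "z > 0" for z
  proof -
    have f: "filterlim (\<lambda>\<tau>. p + inverse \<tau> * z) (at_right p) at_top"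
      unfolding filterlim_at
    proof
      show "\<forall>\<^sub>F \<tau> in at_top. p + inverse \<tau> * z \<in> {p<..} \<and> p + inverse \<tau> * z \<noteq> p"
        using eventually_gt_at_top[of 0] by eventually_elim (use that in \<open>simp\<close>)
    qed (rule shrink)
    have "((\<lambda>\<tau>. (F (p + inverse \<tau> * z) - F p) / (p + inverse \<tau> * z - p)) \<longlongrightarrow> b) at_top"
      using filterlim_compose[OF right[unfolded has_field_derivative_iff] f] by simp
    then have "((\<lambda>\<tau>. exp (- (((F (p + inverse \<tau> * z) - F p) / (p + inverse \<tau> * z - p)) * z))) \<longlongrightarrow> exp (- (b * z))) at_top"
      by (intro tendsto_intros)
    then show "((\<lambda>\<tau>. g \<tau> z) \<longlongrightarrow> exp (- b * z)) at_top"
      using that by (subst (asm) quot) (auto simp: g_def)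
    show "\<forall>\<^sub>F \<tau> in at_top. p + inverse \<tau> * z \<notin> A"
      using A_right f by (auto simp: filterlim_iff)
  qed
  have lim_left: "((\<lambda>\<tau>. g \<tau> z) \<longlongrightarrow> exp (a * z)) at_top"
      and ev_left: "\<forall>\<^sub>F \<tau> in at_top. p + inverse \<tau> * z \<in> A" if "z < 0" for z
  proof -
    have f: "filterlim (\<lambda>\<tau>. p + inverse \<tau> * z) (at_left p) at_top"
      unfolding filterlim_at
    proof
      show "\<forall>\<^sub>F \<tau> in at_top. p + inverse \<tau> * z \<in> {..<p} \<and> p + inverse \<tau> * z \<noteq> p"
        using eventually_gt_at_top[of 0] by eventually_elim (use that in \<open>simp add: mult_pos_neg\<close>)
    qed (rule shrink)
    have "((\<lambda>\<tau>. (F (p + inverse \<tau> * z) - F p) / (p + inverse \<tau> * z - p)) \<longlongrightarrow> - a) at_top"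
      using filterlim_compose[OF left[unfolded has_field_derivative_iff] f] by simp
    then have "((\<lambda>\<tau>. exp (- (((F (p + inverse \<tau> * z) - F p) / (p + inverse \<tau> * z - p)) * z))) \<longlongrightarrow> exp (- (- a * z))) at_top"
      by (intro tendsto_intros)
    then show "((\<lambda>\<tau>. g \<tau> z) \<longlongrightarrow> exp (a * z)) at_top"
      using that by (subst (asm) quot) (auto simp: g_def)
    show "\<forall>\<^sub>F \<tau> in at_top. p + inverse \<tau> * z \<in> A"
      using A_left f by (auto simp: filterlim_iff)
  qed
  have "((\<lambda>\<tau>. LINT z|lborel. g \<tau> z) \<longlongrightarrow> (LINT z|lborel. indicator {..0} z * exp (a * z) + indicator {0..} z * exp (- b * z))) at_top"
  proof (rule integral_dominated_convergence_at_top[where w = "\<lambda>z. exp (- k * \<bar>z\<bar>)"])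
    show "\<forall>\<^sub>F \<tau> in at_top. AE z in lborel. norm (g \<tau> z) \<le> exp (- k * \<bar>z\<bar>)"
      using eventually_gt_at_top[of 0] by eventually_elim (use g_bound in \<open>auto simp: g_def\<close>)
    show "AE z in lborel. ((\<lambda>\<tau>. g \<tau> z) \<longlongrightarrow> indicator {..0} z * exp (a * z) + indicator {0..} z * exp (- b * z)) at_top"
      using AE_lborel_singleton[of 0]
    proof eventually_elim
      case (elim z)
      then show ?case using lim_left[of z] lim_right[of z] by (cases "z < 0") auto
    qed
  qed (use integrable_exp_abs[OF \<open>k > 0\<close>] in auto)
  then have total: "((\<lambda>\<tau>. LINT z|lborel. g \<tau> z) \<longlongrightarrow> 1 / a + 1 / b) at_top"
    using has_bochner_integral_add[OF has_bochner_integral_exp_left[OF \<open>a > 0\<close>]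
        has_bochner_integral_exp_right[OF \<open>b > 0\<close>]]
    by (simp add: has_bochner_integral_iff)
  have "((\<lambda>\<tau>. LINT z|lborel. indicator A (p + inverse \<tau> * z) * g \<tau> z)
      \<longlongrightarrow> (LINT z|lborel. indicator {..0} z * exp (a * z))) at_top"
  proof (rule integral_dominated_convergence_at_top[where w = "\<lambda>z. exp (- k * \<bar>z\<bar>)"])
    show "\<forall>\<^sub>F \<tau> in at_top. AE z in lborel. norm (indicator A (p + inverse \<tau> * z) * g \<tau> z) \<le> exp (- k * \<bar>z\<bar>)"
      using eventually_gt_at_top[of 0]
      by eventually_elim (use g_bound in \<open>auto simp: g_def indicator_def\<close>)
    show "AE z in lborel. ((\<lambda>\<tau>. indicator A (p + inverse \<tau> * z) * g \<tau> z)
        \<longlongrightarrow> indicator {..0} z * exp (a * z)) at_top"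
      using AE_lborel_singleton[of 0]
    proof eventually_elim
      case (elim z)
      show ?case
      proof (cases "z < 0")
        case True
        have "\<forall>\<^sub>F \<tau> in at_top. g \<tau> z = indicator A (p + inverse \<tau> * z) * g \<tau> z"
          using ev_left[OF True] by eventually_elim simp
        from Lim_transform_eventually[OF lim_left[OF True] this] show ?thesis
          using True by simp
      next
        case False
        with elim have "z > 0" by simp
        have "\<forall>\<^sub>F \<tau> in at_top. indicator A (p + inverse \<tau> * z) * g \<tau> z = 0"
          using ev_right[OF \<open>z > 0\<close>] by eventually_elim simp
        then show ?thesis using \<open>z > 0\<close> by (simp add: tendsto_eventually)
      qed
    qed
  qed (use integrable_exp_abs[OF \<open>k > 0\<close>] in auto)
  then have part: "((\<lambda>\<tau>. LINT z|lborel. indicator A (p + inverse \<tau> * z) * g \<tau> z) \<longlongrightarrow> 1 / a) at_top"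
    using has_bochner_integral_exp_left[OF \<open>a > 0\<close>] by (simp add: has_bochner_integral_iff)
  have "\<forall>\<^sub>F \<tau> in at_top. (LINT z|lborel. indicator A (p + inverse \<tau> * z) * g \<tau> z) / (LINT z|lborel. g \<tau> z)
      = mass_fraction A F (inverse \<tau>)"
    using eventually_gt_at_top[of 0]
  proof eventually_elim
    case (elim \<tau>)
    have e: "exp (- (1 / inverse \<tau>) * F (p + inverse \<tau> * z)) = exp (- \<tau> * F p) * g \<tau> z" for z
      by (simp add: g_def exp_add[symmetric] algebra_simps divide_inverse)
    have "(LINT y|lborel. indicator A y * exp (- (1 / inverse \<tau>) * F y))
        = inverse \<tau> * (exp (- \<tau> * F p) * (LINT z|lborel. indicator A (p + inverse \<tau> * z) * g \<tau> z))"
      using lborel_integral_real_affine[of "inverse \<tau>" "\<lambda>y. indicator A y * exp (- (1 / inverse \<tau>) * F y)" p, unfolded e] elim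
      by (simp add: mult.left_commute)
    moreover have "(LINT y|lborel. exp (- (1 / inverse \<tau>) * F y))
        = inverse \<tau> * (exp (- \<tau> * F p) * (LINT z|lborel. g \<tau> z))"
      using lborel_integral_real_affine[of "inverse \<tau>" "\<lambda>y. exp (- (1 / inverse \<tau>) * F y)" p, unfolded e] elim
      by simp
    ultimately show ?case using elim by (simp add: mass_fraction_def)
  qed
  moreover have "((\<lambda>\<tau>. (LINT z|lborel. indicator A (p + inverse \<tau> * z) * g \<tau> z) / (LINT z|lborel. g \<tau> z))
      \<longlongrightarrow> (1 / a) / (1 / a + 1 / b)) at_top"
    by (intro tendsto_divide part total) (use \<open>a > 0\<close> \<open>b > 0\<close> in \<open>simp add: field_simps add_pos_pos\<close>)
  moreover have "(1 / a) / (1 / a + 1 / b) = b / (a + b)"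
    using \<open>a > 0\<close> \<open>b > 0\<close> by (simp add: field_simps)
  ultimately show ?thesis
    by (simp add: filterlim_at_right_to_top tendsto_cong)
qed

section \<open>The phase of a single plateau\<close>

definition phase :: "real \<Rightarrow> real \<Rightarrow> real \<Rightarrow> real \<Rightarrow> real \<Rightarrow> real" where
  "phase \<sigma> l x t y = \<sigma> * max (- l) (min l y) + (x - y)\<^sup>2 / (2 * t)"

lemma phase_measurable [measurable]: "phase \<sigma> l x t \<in> borel_measurable borel"
  unfolding phase_def by measurable

lemma isCont_phase: "t > 0 \<Longrightarrow> isCont (phase \<sigma> l x t) y"
  unfolding phase_def by (intro continuous_intros) auto

text \<open>
  The quadratic term dominates: \<open>(\<bar>y - x\<bar> - t\<nu>)\<^sup>2 \<ge> 0\<close> bounds it below by a linear function, and so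
  reduces Gaussian decay to exponential decay.
\<close>

lemma integrable_exp_phase:
  assumes "l > 0" "t > 0" "\<nu> > 0"
  shows "integrable lborel (\<lambda>y. exp (- (1 / \<nu>) * phase \<sigma> l x t y))"
proof (rule Bochner_Integration.integrable_bound)
  let ?C = "exp (\<bar>\<sigma>\<bar> * l / \<nu> + t * \<nu> / 2)"
  show "integrable lborel (\<lambda>y. ?C * exp (- \<bar>y - x\<bar>))"
    using lborel_integrable_real_affine[OF integrable_exp_abs[of 1], of 1 "- x"] by simp
  have "- (1 / \<nu>) * phase \<sigma> l x t y \<le> \<bar>\<sigma>\<bar> * l / \<nu> + t * \<nu> / 2 - \<bar>y - x\<bar>" for y
  proof -
    have "\<bar>\<sigma> * max (- l) (min l y)\<bar> \<le> \<bar>\<sigma>\<bar> * l"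
      unfolding abs_mult using assms by (intro mult_left_mono) auto
    then have "- (\<bar>\<sigma>\<bar> * l) + (x - y)\<^sup>2 / (2 * t) \<le> phase \<sigma> l x t y"
      unfolding phase_def by linarith
    then have "(- (\<bar>\<sigma>\<bar> * l) + (x - y)\<^sup>2 / (2 * t)) / \<nu> \<le> phase \<sigma> l x t y / \<nu>"
      using assms by (intro divide_right_mono) auto
    moreover have "0 \<le> (\<bar>y - x\<bar> - t * \<nu>)\<^sup>2 / (2 * t * \<nu>)" using assms by simp
    moreover have "(\<bar>y - x\<bar> - t * \<nu>)\<^sup>2 / (2 * t * \<nu>) = (x - y)\<^sup>2 / (2 * t) / \<nu> - \<bar>y - x\<bar> + t * \<nu> / 2"
      using assms by (simp add: power2_diff field_simps power2_eq_square)
    ultimately show ?thesis by (simp add: diff_divide_distrib)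
  qed
  then show "AE y in lborel. norm (exp (- (1 / \<nu>) * phase \<sigma> l x t y)) \<le> norm (?C * exp (- \<bar>y - x\<bar>))"
    by (simp add: exp_add[symmetric])
qed measurable

lemma interval_integral_indicator:
  assumes "l > 0"
  shows "(LBINT z=ereal 0..ereal y. indicator {- l..l} z) = max (- l) (min l y)"
proof (cases "y \<ge> 0")
  case True
  have "(LBINT z=ereal 0..ereal y. indicator {- l..l} z) = (LINT z|lborel. indicator {0..min l y} z :: real)"
    unfolding interval_integral_Icc[OF True] set_lebesgue_integral_def
    using assms by (intro Bochner_Integration.integral_cong) (auto simp: indicator_def)
  then show ?thesis using True assms by simp
next
  case False
  then have y: "y \<le> 0" by simp
  have "(LBINT z=ereal y..ereal 0. indicator {- l..l} z) = (LINT z|lborel. indicator {max (- l) y..0} z :: real)"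
    unfolding interval_integral_Icc[OF y] set_lebesgue_integral_def
    using assms by (intro Bochner_Integration.integral_cong) (auto simp: indicator_def)
  then show ?thesis
    using y assms by (simp add: interval_integral_endpoints_reverse[of "ereal 0"])
qed

text \<open>
  The data are not prescribed at \<open>\<plusminus>l\<close>, so neither the potential nor the numerator can be computed
  pointwise; both integrands are replaced by indicators off the null set \<open>{-l, l}\<close>.
\<close>

lemma viscous_solution_eq_mass_fraction:
  assumes "l > 0"
    and left: "\<And>j y. j \<in> {1..N} \<Longrightarrow> y < - l \<Longrightarrow> v j y = 0"
    and mid: "\<And>j y. j \<in> {1..N} \<Longrightarrow> - l < y \<Longrightarrow> y < l \<Longrightarrow> v j y = u0 j"
    and right: "\<And>j y. j \<in> {1..N} \<Longrightarrow> y > l \<Longrightarrow> v j y = 0"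
    and \<sigma>: "\<sigma> = (\<Sum>k=1..N. c k * u0 k)"
    and j: "j \<in> {1..N}"
  shows "viscous_solution N c v \<nu> j x t = u0 j * mass_fraction {- l<..<l} (phase \<sigma> l x t) \<nu>"
proof -
  have v: "v k z = u0 k * indicator {- l..l} z" "v k z = u0 k * indicator {- l<..<l} z"
    if "k \<in> {1..N}" "z \<notin> {- l, l}" for k z
    using left[of k z] mid[of k z] right[of k z] that by (auto simp: indicator_def not_le not_less)
  have sum_v: "(\<Sum>k=1..N. c k * v k z) = \<sigma> * indicator {- l..l} z" if "z \<notin> {- l, l}" for z
    unfolding \<sigma> sum_distrib_right by (intro sum.cong) (use that in \<open>auto simp: v\<close>)
  have pot: "potential N c v y = \<sigma> * max (- l) (min l y)" for y
  proof -
    have "potential N c v y = (LBINT z=ereal 0..ereal y. \<sigma> * indicator {- l..l} z)"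
      unfolding potential_def
      by (rule interval_integral_discrete_difference[where X = "{- l, l}"]) (auto intro!: sum_v[simplified])
    then show ?thesis by (simp add: interval_integral_indicator[OF \<open>l > 0\<close>])
  qed
  have ker: "kernel N c v \<nu> x t = (\<lambda>y. exp (- (1 / \<nu>) * phase \<sigma> l x t y))"
    by (simp add: fun_eq_iff kernel_def pot phase_def)
  have "(LINT y|lborel. v j y * kernel N c v \<nu> x t y)
      = (LINT y|lborel. u0 j * (indicator {- l<..<l} y * exp (- (1 / \<nu>) * phase \<sigma> l x t y)))"
    by (rule integral_discrete_difference[where X = "{- l, l}"]) (auto simp: ker v(2)[OF j])
  then show ?thesis
    by (simp add: viscous_solution_def mass_fraction_def ker)
qed

text \<open>
  The substitution \<open>y \<mapsto> -y\<close>, under which the clamp function is odd and the interval is symmetric.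
  It carries every result for \<open>\<sigma> \<le> 0\<close> over to \<open>\<sigma> \<ge> 0\<close>.
\<close>

lemma mass_fraction_phase_reflect:
  "mass_fraction {- l<..<l} (phase (- \<sigma>) l (- x) t) = mass_fraction {- l<..<l} (phase \<sigma> l x t)"
proof
  fix \<nu>
  have p: "phase (- \<sigma>) l (- x) t (- y) = phase \<sigma> l x t y" if "l \<ge> 0" for y
  proof -
    have "max (- l) (min l (- y)) = - max (- l) (min l y)" using that by (auto simp: max_def min_def)
    moreover have "(- x - - y)\<^sup>2 = (x - y)\<^sup>2" by (simp add: power2_eq_square algebra_simps)
    ultimately show ?thesis by (simp add: phase_def)
  qed
  show "mass_fraction {- l<..<l} (phase (- \<sigma>) l (- x) t) \<nu> = mass_fraction {- l<..<l} (phase \<sigma> l x t) \<nu>"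
  proof (cases "l \<ge> 0")
    case True
    have i: "indicator {- l<..<l} (- y) = (indicator {- l<..<l} y :: real)" for y
      by (auto simp: indicator_def)
    show ?thesis
      unfolding mass_fraction_def
      using lborel_integral_real_affine[of "-1" "\<lambda>y. indicator {- l<..<l} y * exp (- (1 / \<nu>) * phase (- \<sigma>) l (- x) t y)" 0]
        lborel_integral_real_affine[of "-1" "\<lambda>y. exp (- (1 / \<nu>) * phase (- \<sigma>) l (- x) t y)" 0]
      by (simp add: i p[OF True])
  qed (simp add: mass_fraction_def)
qed

section \<open>Locating the minimum for nonpositive speed\<close>

text \<open>
  The left-hand side is the phase inside the plateau. Its vertex \<open>x - \<sigma>t\<close> is the foot of the characteristic
  of speed \<open>\<sigma>\<close> through \<open>(x,t)\<close>.
\<close>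

lemma linear_phase_complete_square:
  fixes \<sigma> x y t :: real
  assumes "t > 0"
  shows "\<sigma> * y + (x - y)\<^sup>2 / (2 * t) = (y - (x - \<sigma> * t))\<^sup>2 / (2 * t) + \<sigma> * x - \<sigma>\<^sup>2 * t / 2"
  using assms by (simp add: field_simps power2_eq_square)

context
  fixes \<sigma> l x t :: real
  assumes l: "l > 0" and t: "t > 0"
begin

text \<open>
  Right of the plateau \<open>y = x\<close> minimises both terms of the phase at once.
\<close>

lemma plateau_fraction_right:
  assumes "\<sigma> \<le> 0" "l < x"
  shows "(mass_fraction {- l<..<l} (phase \<sigma> l x t) \<longlongrightarrow> 0) (at_right 0)"
proof (rule laplace_avoids)
  show "(x - l)\<^sup>2 / (2 * t) > 0" using assms t by simp
  fix y assume "y \<in> {- l<..<l}"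
  then have "- l < y" "y < l" by auto
  then have "(x - l)\<^sup>2 / (2 * t) \<le> (x - y)\<^sup>2 / (2 * t)" "\<sigma> * l \<le> \<sigma> * y"
    using assms t by (auto intro!: divide_right_mono power_mono mult_left_mono_neg)
  then show "phase \<sigma> l x t x + (x - l)\<^sup>2 / (2 * t) \<le> phase \<sigma> l x t y"
    using \<open>l < x\<close> l \<open>- l < y\<close> \<open>y < l\<close> by (simp add: phase_def)
qed ((rule greaterThanLessThan_borel integrable_exp_phase isCont_phase l t | assumption)+)

text \<open>
  The phase is \<open>-\<sigma>l\<close> at \<open>x\<close> and at least \<open>\<sigma>x - \<sigma>\<^sup>2t/2\<close> on the plateau. These two values tie on
  the shock line \<open>x = \<sigma>t/2 - l\<close>.
\<close>

lemma plateau_fraction_left_of_shock: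
  assumes "\<sigma> < 0" "x < \<sigma> / 2 * t - l"
  shows "(mass_fraction {- l<..<l} (phase \<sigma> l x t) \<longlongrightarrow> 0) (at_right 0)"
proof (rule laplace_avoids)
  show "- \<sigma> * (\<sigma> / 2 * t - l - x) > 0" using assms by (intro mult_pos_pos) auto
  have "\<sigma> * t < 0" using assms t by (simp add: mult_neg_pos)
  then have "x < - l" using assms by simp
  fix y assume y: "y \<in> {- l<..<l}"
  have "phase \<sigma> l x t y = (y - (x - \<sigma> * t))\<^sup>2 / (2 * t) + \<sigma> * x - \<sigma>\<^sup>2 * t / 2"
    using y by (simp add: phase_def flip: linear_phase_complete_square[OF t])
  moreover have "(y - (x - \<sigma> * t))\<^sup>2 / (2 * t) \<ge> 0" using t by simp
  moreover have "phase \<sigma> l x t x = - \<sigma> * l" using \<open>x < - l\<close> l by (simp add: phase_def)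
  ultimately show "phase \<sigma> l x t x + - \<sigma> * (\<sigma> / 2 * t - l - x) \<le> phase \<sigma> l x t y"
    by (simp add: algebra_simps power2_eq_square)
qed ((rule greaterThanLessThan_borel integrable_exp_phase isCont_phase l t | assumption)+)

text \<open>
  After the time \<open>-4l/\<sigma>\<close> the fan has absorbed the constant state. If the vertex \<open>x - \<sigma>t\<close> lies left of
  \<open>l\<close>, then \<open>x\<close> is still left of the line \<open>x = \<sigma>t/2 - l\<close>; otherwise the phase decreases along the
  plateau, and its infimum there, \<open>\<sigma>l + (x - l)\<^sup>2/(2t)\<close>, has to be compared with the value \<open>-\<sigma>l\<close> at \<open>x\<close>.
\<close>

lemma plateau_fraction_left_late:
  assumes "\<sigma> < 0" "x < l - sqrt (- 4 * l * \<sigma> * t)" "t > - 4 * l / \<sigma>"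
  shows "(mass_fraction {- l<..<l} (phase \<sigma> l x t) \<longlongrightarrow> 0) (at_right 0)"
proof (cases "x < l + \<sigma> * t")
  case True
  have "- \<sigma> * t > 4 * l" using assms by (simp add: field_simps)
  then show ?thesis
    using True assms by (intro plateau_fraction_left_of_shock) auto
next
  case False
  have "- \<sigma> * t > 4 * l" using assms by (simp add: field_simps)
  have "l * (4 * l) \<le> l * (- \<sigma> * t)" using \<open>- \<sigma> * t > 4 * l\<close> l by (intro mult_left_mono) auto
  then have "(4 * l)\<^sup>2 \<le> - 4 * l * \<sigma> * t" by (simp add: power2_eq_square algebra_simps)
  then have "4 * l \<le> sqrt (- 4 * l * \<sigma> * t)" by (rule real_le_rsqrt)
  then have "x < - l" using assms l by simp
  have "- 4 * l * \<sigma> * t < (l - x)\<^sup>2"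
    using assms(2) real_le_rsqrt[of "l - x" "- 4 * l * \<sigma> * t"] by linarith
  show ?thesis
  proof (rule laplace_avoids)
    show "(x - l)\<^sup>2 / (2 * t) + 2 * \<sigma> * l > 0"
      using \<open>- 4 * l * \<sigma> * t < (l - x)\<^sup>2\<close> t by (simp add: field_simps power2_commute)
    fix y assume y: "y \<in> {- l<..<l}"
    have "(l - (x - \<sigma> * t))\<^sup>2 \<le> (y - (x - \<sigma> * t))\<^sup>2"
      using y False unfolding abs_le_square_iff[symmetric] by auto
    then have "\<sigma> * l + (x - l)\<^sup>2 / (2 * t) \<le> phase \<sigma> l x t y"
      using y t by (simp add: phase_def linear_phase_complete_square[OF t] divide_right_mono)
    then show "phase \<sigma> l x t x + ((x - l)\<^sup>2 / (2 * t) + 2 * \<sigma> * l) \<le> phase \<sigma> l x t y"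
      using \<open>x < - l\<close> l by (simp add: phase_def)
  qed ((rule greaterThanLessThan_borel integrable_exp_phase isCont_phase l t | assumption)+)
qed

text \<open>
  The minimum is the vertex \<open>m = x - \<sigma>t\<close>. Right of the plateau the phase exceeds the parabola with
  vertex \<open>m\<close>; left of it the phase is at least \<open>-\<sigma>l\<close>, which exceeds its value at \<open>m\<close> on this side of the shock
  line.
\<close>

lemma plateau_fraction_inside:
  assumes "\<sigma> < 0" "\<sigma> / 2 * t - l < x" "x < \<sigma> * t + l"
  shows "(mass_fraction {- l<..<l} (phase \<sigma> l x t) \<longlongrightarrow> 1) (at_right 0)"
proof (rule laplace_concentrates)
  define m where "m = x - \<sigma> * t"
  define \<delta> where "\<delta> = min ((l - m)\<^sup>2 / (2 * t)) (- \<sigma> * (x + l - \<sigma> / 2 * t))"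
  have "\<sigma> * t < 0" using assms t by (simp add: mult_neg_pos)
  then have "- l < m" "m < l" using assms by (auto simp: m_def)
  show "\<delta> > 0" using assms t \<open>m < l\<close> by (auto simp: \<delta>_def intro!: mult_neg_pos)
  have Fm: "phase \<sigma> l x t m = \<sigma> * x - \<sigma>\<^sup>2 * t / 2"
    using linear_phase_complete_square[OF t, where y = m and x = x and \<sigma> = \<sigma>] \<open>- l < m\<close> \<open>m < l\<close> by (simp add: phase_def m_def)
  fix y assume "y \<notin> {- l<..<l}"
  then consider "y \<le> - l" | "l \<le> y" by force
  then show "phase \<sigma> l x t m + \<delta> \<le> phase \<sigma> l x t y"
  proof cases
    case 1
    have "phase \<sigma> l x t y \<ge> - \<sigma> * l" using 1 l t by (simp add: phase_def)
    moreover have "\<delta> \<le> - \<sigma> * (x + l - \<sigma> / 2 * t)" by (simp add: \<delta>_def)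
    ultimately show ?thesis by (simp add: Fm algebra_simps power2_eq_square)
  next
    case 2
    have "(l - m)\<^sup>2 / (2 * t) \<le> (y - m)\<^sup>2 / (2 * t)"
      using 2 \<open>m < l\<close> t by (intro divide_right_mono power_mono) auto
    moreover have "\<sigma> * y \<le> \<sigma> * l" using 2 assms by (intro mult_left_mono_neg) auto
    moreover have "\<delta> \<le> (l - m)\<^sup>2 / (2 * t)" by (simp add: \<delta>_def)
    ultimately show ?thesis
      using linear_phase_complete_square[OF t, where y = y and x = x and \<sigma> = \<sigma>, folded m_def] 2 l Fm phase_def[of \<sigma> l x t y] by simp
  qed
qed ((rule greaterThanLessThan_borel integrable_exp_phase isCont_phase l t | assumption)+)

text \<open>
  This case is separate because for \<open>\<sigma> = 0\<close> the gap \<open>-\<sigma>(x + l - \<sigma>t/2)\<close> used for \<open>\<sigma> < 0\<close> degenerates to 0.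
\<close>

lemma plateau_fraction_zero_speed:
  assumes "\<sigma> = 0" "- l < x" "x < l"
  shows "(mass_fraction {- l<..<l} (phase \<sigma> l x t) \<longlongrightarrow> 1) (at_right 0)"
proof (rule laplace_concentrates)
  define d where "d = min (x + l) (l - x)"
  have "d > 0" using assms by (simp add: d_def)
  then show "d\<^sup>2 / (2 * t) > 0" using t by simp
  fix y assume "y \<notin> {- l<..<l}"
  then have "\<bar>d\<bar> \<le> \<bar>x - y\<bar>" using assms by (auto simp: d_def)
  then have "d\<^sup>2 / (2 * t) \<le> (x - y)\<^sup>2 / (2 * t)"
    using t by (intro divide_right_mono) (auto simp: abs_le_square_iff)
  then show "phase \<sigma> l x t x + d\<^sup>2 / (2 * t) \<le> phase \<sigma> l x t y"
    by (simp add: phase_def assms)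
qed ((rule greaterThanLessThan_borel integrable_exp_phase isCont_phase l t | assumption)+)

text \<open>
  Here \<open>l\<close> is the minimum: the phase has slopes \<open>\<sigma> + b < 0\<close> and \<open>b > 0\<close> at \<open>l\<close>, and the condition with
  the square root ensures that the value at \<open>l\<close> is below all values on the far side of the plateau.
\<close>

lemma plateau_fraction_fan:
  assumes "\<sigma> < 0" "x < l" "\<sigma> * t + l < x" "l - sqrt (- 4 * l * \<sigma> * t) < x"
  shows "(mass_fraction {- l<..<l} (phase \<sigma> l x t) \<longlongrightarrow> (x - l) / (\<sigma> * t)) (at_right 0)"
proof -
  define b where "b = (l - x) / t"
  \<comment> \<open>For \<open>y \<le> -l\<close> the increment of the phase from \<open>l\<close> is \<open>q\<^sup>2t/2 - bs + s\<^sup>2/(2t)\<close> with \<open>s = l - y\<close>,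
    and \<open>(qt - s)\<^sup>2 \<ge> 0\<close> bounds it below by \<open>(q - b)s\<close>.\<close>
  define q where "q = sqrt (- 4 * l * \<sigma> * t) / t"
  define k where "k = min (min (- \<sigma> - b) b) (q - b)"
  have "b > 0" using assms t by (simp add: b_def)
  have "- \<sigma> - b > 0" using assms t by (simp add: b_def field_simps)
  have "q - b > 0" using assms t by (simp add: b_def q_def field_simps)
  have "- 4 * l * \<sigma> * t \<ge> 0" using l t assms by (simp add: mult_nonneg_nonpos mult_nonpos_nonneg)
  then have q2: "q\<^sup>2 * t = - 4 * l * \<sigma>" using t by (simp add: q_def power_divide power2_eq_square)
  have "k > 0" using \<open>b > 0\<close> \<open>- \<sigma> - b > 0\<close> \<open>q - b > 0\<close> by (simp add: k_def)
  have sq: "(x - y)\<^sup>2 / (2 * t) = (x - l)\<^sup>2 / (2 * t) + b * (y - l) + (y - l)\<^sup>2 / (2 * t)" for y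
    using t by (simp add: b_def field_simps power2_eq_square)
  have coercive: "phase \<sigma> l x t l + k * \<bar>y - l\<bar> \<le> phase \<sigma> l x t y" for y
  proof -
    have "(y - l)\<^sup>2 / (2 * t) \<ge> 0" using t by simp
    consider "y \<le> - l" | "- l < y" "y \<le> l" | "l < y" by linarith
    then show ?thesis
    proof cases
      case 1
      have "k * (l - y) \<le> (q - b) * (l - y)" using 1 l by (intro mult_right_mono) (auto simp: k_def)
      moreover have "0 \<le> (q * t - (l - y))\<^sup>2 / (2 * t)" using t by simp
      moreover have "(q * t - (l - y))\<^sup>2 / (2 * t) = q\<^sup>2 * t / 2 - q * (l - y) + (y - l)\<^sup>2 / (2 * t)"
        using t by (simp add: field_simps power2_eq_square)
      ultimately show ?thesis using 1 l sq[of y] q2 by (simp add: phase_def algebra_simps)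
    next
      case 2
      have "k * (l - y) \<le> (- \<sigma> - b) * (l - y)" using 2 by (intro mult_right_mono) (auto simp: k_def)
      then show ?thesis using 2 l sq[of y] \<open>(y - l)\<^sup>2 / (2 * t) \<ge> 0\<close> by (simp add: phase_def algebra_simps)
    next
      case 3
      have "k * (y - l) \<le> b * (y - l)" using 3 by (intro mult_right_mono) (auto simp: k_def)
      then show ?thesis using 3 l sq[of y] \<open>(y - l)\<^sup>2 / (2 * t) \<ge> 0\<close> by (simp add: phase_def algebra_simps)
    qed
  qed
  have ev_left: "\<forall>\<^sub>F y in at_left l. y \<in> {- l<..<l}"
    using eventually_at_left_real[of "- l" l] l by simp
  have "(mass_fraction {- l<..<l} (phase \<sigma> l x t) \<longlongrightarrow> b / ((- \<sigma> - b) + b)) (at_right 0)"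
  proof (rule laplace_corner[OF _ _ \<open>k > 0\<close> coercive _ _ ev_left])
    have "((\<lambda>y. \<sigma> * y + (x - y)\<^sup>2 / (2 * t)) has_real_derivative - (- \<sigma> - b)) (at_left l)"
      using t by (auto intro!: derivative_eq_intros simp: b_def field_simps)
    moreover have "\<forall>\<^sub>F y in at_left l. phase \<sigma> l x t y = \<sigma> * y + (x - y)\<^sup>2 / (2 * t)"
      using ev_left by eventually_elim (simp add: phase_def)
    ultimately show "(phase \<sigma> l x t has_real_derivative - (- \<sigma> - b)) (at_left l)"
      using l by (subst has_field_derivative_cong_eventually) (auto simp: phase_def)
    have "((\<lambda>y. \<sigma> * l + (x - y)\<^sup>2 / (2 * t)) has_real_derivative b) (at_right l)"
      using t by (auto intro!: derivative_eq_intros simp: b_def field_simps)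
    moreover have "\<forall>\<^sub>F y in at_right l. phase \<sigma> l x t y = \<sigma> * l + (x - y)\<^sup>2 / (2 * t)"
      using eventually_at_right_less[of l] by eventually_elim (use l in \<open>simp add: phase_def\<close>)
    ultimately show "(phase \<sigma> l x t has_real_derivative b) (at_right l)"
      using l by (subst has_field_derivative_cong_eventually) (auto simp: phase_def)
    show "\<forall>\<^sub>F y in at_right l. y \<notin> {- l<..<l}"
      using eventually_at_right_less[of l] by eventually_elim simp
  qed auto
  moreover have "b / ((- \<sigma> - b) + b) = (x - l) / (\<sigma> * t)"
    using assms t by (simp add: b_def field_simps)
  ultimately show ?thesis by simp
qed

end


text \<open>
  The line \<open>x = \<sigma>t + l\<close> and the parabola \<open>(l - x)\<^sup>2 = -4l\<sigma>t\<close> bounding the fan cross at the time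
  \<open>-4l/\<sigma>\<close>: before it the line is the stronger condition on \<open>x\<close>, after it the parabola.
\<close>

lemma square_root_regions:
  fixes \<sigma> l x t :: real
  assumes "l > 0" "t > 0" "\<sigma> < 0"
  shows "x < l \<Longrightarrow> \<sigma> * t + l < x \<Longrightarrow> t < - 4 * l / \<sigma> \<Longrightarrow> l - sqrt (- 4 * l * \<sigma> * t) < x"
    and "l - sqrt (- 4 * l * \<sigma> * t) < x \<Longrightarrow> t > - 4 * l / \<sigma> \<Longrightarrow> \<sigma> * t + l < x"
proof -
  have pos: "- \<sigma> * t > 0" using assms by (simp add: mult_neg_pos)
  {
    assume "x < l" "\<sigma> * t + l < x" "t < - 4 * l / \<sigma>"
    have "- \<sigma> * t < 4 * l" using assms \<open>t < - 4 * l / \<sigma>\<close> by (simp add: field_simps)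
    then have "(- \<sigma> * t) * (- \<sigma> * t) \<le> 4 * l * (- \<sigma> * t)"
      using pos by (intro mult_right_mono) auto
    then have "- \<sigma> * t \<le> sqrt (- 4 * l * \<sigma> * t)"
      by (intro real_le_rsqrt) (simp add: power2_eq_square algebra_simps)
    then show "l - sqrt (- 4 * l * \<sigma> * t) < x" using \<open>\<sigma> * t + l < x\<close> by simp
  next
    assume "l - sqrt (- 4 * l * \<sigma> * t) < x" "t > - 4 * l / \<sigma>"
    have "- \<sigma> * t > 4 * l" using assms \<open>t > - 4 * l / \<sigma>\<close> by (simp add: field_simps)
    then have "4 * l * (- \<sigma> * t) \<le> (- \<sigma> * t) * (- \<sigma> * t)"
      using pos by (intro mult_right_mono) auto
    then have "sqrt (- 4 * l * \<sigma> * t) \<le> - \<sigma> * t"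
      using pos by (intro real_le_lsqrt) (auto simp: power2_eq_square algebra_simps)
    then show "\<sigma> * t + l < x" using \<open>l - sqrt (- 4 * l * \<sigma> * t) < x\<close> by simp
  }
qed

lemma plateau_fraction_fan_early:
  assumes "l > 0" "t > 0" "\<sigma> < 0" "\<sigma> * t + l < x" "x < l" "t < - 4 * l / \<sigma>"
  shows "(mass_fraction {- l<..<l} (phase \<sigma> l x t) \<longlongrightarrow> (x - l) / (\<sigma> * t)) (at_right 0)"
  by (rule plateau_fraction_fan) (fact assms square_root_regions(1)[OF assms(1-3,5,4,6)])+

lemma plateau_fraction_fan_late:
  assumes "l > 0" "t > 0" "\<sigma> < 0" "l - sqrt (- 4 * l * \<sigma> * t) < x" "x < l" "t > - 4 * l / \<sigma>"
  shows "(mass_fraction {- l<..<l} (phase \<sigma> l x t) \<longlongrightarrow> (x - l) / (\<sigma> * t)) (at_right 0)"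
  by (rule plateau_fraction_fan) (fact assms square_root_regions(2)[OF assms(1-4,6)])+

lemmas plateau_fraction_nonpos_speed =
  plateau_fraction_right plateau_fraction_zero_speed plateau_fraction_left_of_shock
  plateau_fraction_inside plateau_fraction_fan_early plateau_fraction_left_late plateau_fraction_fan_late

section \<open>The inviscid limit\<close>

theorem theorem3p2:
  fixes N :: nat and c u0 :: "nat \<Rightarrow> real" and l \<sigma>\<^sub>0 :: real
    and v :: "nat \<Rightarrow> real \<Rightarrow> real"
  assumes "N \<ge> 1" and "l > 0"
    and init_left: "\<And>j y. j \<in> {1..N} \<Longrightarrow> y < - l \<Longrightarrow> v j y = 0"
    and init_mid: "\<And>j y. j \<in> {1..N} \<Longrightarrow> - l < y \<Longrightarrow> y < l \<Longrightarrow> v j y = u0 j"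
    and init_right: "\<And>j y. j \<in> {1..N} \<Longrightarrow> y > l \<Longrightarrow> v j y = 0"
    and sigma: "\<sigma>\<^sub>0 = (\<Sum>k=1..N. c k * u0 k)"
  shows "\<forall>j\<in>{1..N}. \<forall>x t. t > 0 \<longrightarrow>
    (let has_limit = (\<lambda>L. ((\<lambda>\<nu>. viscous_solution N c v \<nu> j x t) \<longlongrightarrow> L) (at_right 0)) in
      (\<sigma>\<^sub>0 = 0 \<longrightarrow>
        (x < - l \<longrightarrow> has_limit 0) \<and>
        (- l < x \<and> x < l \<longrightarrow> has_limit (u0 j)) \<and>
        (x > l \<longrightarrow> has_limit 0)) \<and>
      (\<sigma>\<^sub>0 < 0 \<longrightarrow>
        (x < \<sigma>\<^sub>0 / 2 * t - l \<and> t < - 4 * l / \<sigma>\<^sub>0 \<longrightarrow> has_limit 0) \<and>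
        (\<sigma>\<^sub>0 / 2 * t - l < x \<and> x < \<sigma>\<^sub>0 * t + l \<and> t < - 4 * l / \<sigma>\<^sub>0 \<longrightarrow> has_limit (u0 j)) \<and>
        (\<sigma>\<^sub>0 * t + l < x \<and> x < l \<and> t < - 4 * l / \<sigma>\<^sub>0 \<longrightarrow>
           has_limit (u0 j / \<sigma>\<^sub>0 * ((x - l) / t))) \<and>
        (x < l - sqrt (- 4 * l * \<sigma>\<^sub>0 * t) \<and> t > - 4 * l / \<sigma>\<^sub>0 \<longrightarrow> has_limit 0) \<and>
        (l - sqrt (- 4 * l * \<sigma>\<^sub>0 * t) < x \<and> x < l \<and> t > - 4 * l / \<sigma>\<^sub>0 \<longrightarrow>
           has_limit (u0 j / \<sigma>\<^sub>0 * ((x - l) / t))) \<and>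
        (x > l \<longrightarrow> has_limit 0)) \<and>
      (\<sigma>\<^sub>0 > 0 \<longrightarrow>
        (x > \<sigma>\<^sub>0 / 2 * t + l \<and> t < 4 * l / \<sigma>\<^sub>0 \<longrightarrow> has_limit 0) \<and>
        (\<sigma>\<^sub>0 * t - l < x \<and> x < \<sigma>\<^sub>0 / 2 * t + l \<and> t < 4 * l / \<sigma>\<^sub>0 \<longrightarrow> has_limit (u0 j)) \<and>
        (- l < x \<and> x < \<sigma>\<^sub>0 * t - l \<and> t < 4 * l / \<sigma>\<^sub>0 \<longrightarrow>
           has_limit (u0 j / \<sigma>\<^sub>0 * ((x + l) / t))) \<and>
        (x > - l + sqrt (4 * l * \<sigma>\<^sub>0 * t) \<and> t > 4 * l / \<sigma>\<^sub>0 \<longrightarrow> has_limit 0) \<and>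
        (- l < x \<and> x < - l + sqrt (4 * l * \<sigma>\<^sub>0 * t) \<and> t > 4 * l / \<sigma>\<^sub>0 \<longrightarrow>
           has_limit (u0 j / \<sigma>\<^sub>0 * ((x + l) / t))) \<and>
        (x < - l \<longrightarrow> has_limit 0)))"
proof (intro ballI allI impI)
  fix j x t
  assume j: "j \<in> {1..N}" and t: "(t::real) > 0"
  define R where "R = mass_fraction {- l<..<l} (phase \<sigma>\<^sub>0 l x t)"
  have sol: "(\<lambda>\<nu>. viscous_solution N c v \<nu> j x t) = (\<lambda>\<nu>. u0 j * R \<nu>)"
    unfolding R_def
    by (intro ext viscous_solution_eq_mass_fraction[OF \<open>l > 0\<close> _ _ _ sigma j])
      (fact init_left init_mid init_right)+
  have lim: "((\<lambda>\<nu>. viscous_solution N c v \<nu> j x t) \<longlongrightarrow> L) (at_right 0)"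
    if "(R \<longlongrightarrow> r) (at_right 0)" "L = u0 j * r" for r L
    unfolding sol that(2) by (intro tendsto_mult_left that(1))
  have refl: "R = mass_fraction {- l<..<l} (phase (- \<sigma>\<^sub>0) l (- x) t)"
    by (simp add: R_def mass_fraction_phase_reflect)
  note neg = plateau_fraction_nonpos_speed[OF \<open>l > 0\<close> t, where \<sigma> = \<sigma>\<^sub>0 and x = x, folded R_def]
  note reflected = plateau_fraction_nonpos_speed[OF \<open>l > 0\<close> t, where \<sigma> = "- \<sigma>\<^sub>0" and x = "- x", folded refl]
  have m: "(- x - l) / (\<sigma>\<^sub>0 * t) = - ((x + l) / (\<sigma>\<^sub>0 * t))"
    unfolding minus_divide_left by simp
  have pos:
    "\<sigma>\<^sub>0 \<ge> 0 \<Longrightarrow> x < - l \<Longrightarrow> (R \<longlongrightarrow> 0) (at_right 0)"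
    "\<sigma>\<^sub>0 > 0 \<Longrightarrow> x > \<sigma>\<^sub>0 / 2 * t + l \<Longrightarrow> (R \<longlongrightarrow> 0) (at_right 0)"
    "\<sigma>\<^sub>0 > 0 \<Longrightarrow> \<sigma>\<^sub>0 * t - l < x \<Longrightarrow> x < \<sigma>\<^sub>0 / 2 * t + l \<Longrightarrow> (R \<longlongrightarrow> 1) (at_right 0)"
    "\<sigma>\<^sub>0 > 0 \<Longrightarrow> - l < x \<Longrightarrow> x < \<sigma>\<^sub>0 * t - l \<Longrightarrow> t < 4 * l / \<sigma>\<^sub>0 \<Longrightarrow>
       (R \<longlongrightarrow> (x + l) / (\<sigma>\<^sub>0 * t)) (at_right 0)"
    "\<sigma>\<^sub>0 > 0 \<Longrightarrow> x > - l + sqrt (4 * l * \<sigma>\<^sub>0 * t) \<Longrightarrow> t > 4 * l / \<sigma>\<^sub>0 \<Longrightarrow> (R \<longlongrightarrow> 0) (at_right 0)"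
    "\<sigma>\<^sub>0 > 0 \<Longrightarrow> - l < x \<Longrightarrow> x < - l + sqrt (4 * l * \<sigma>\<^sub>0 * t) \<Longrightarrow> t > 4 * l / \<sigma>\<^sub>0 \<Longrightarrow>
       (R \<longlongrightarrow> (x + l) / (\<sigma>\<^sub>0 * t)) (at_right 0)"
    using reflected by (simp_all add: m)
  show "let has_limit = \<lambda>L. ((\<lambda>\<nu>. viscous_solution N c v \<nu> j x t) \<longlongrightarrow> L) (at_right 0) in
      (\<sigma>\<^sub>0 = 0 \<longrightarrow>
        (x < - l \<longrightarrow> has_limit 0) \<and>
        (- l < x \<and> x < l \<longrightarrow> has_limit (u0 j)) \<and>
        (x > l \<longrightarrow> has_limit 0)) \<and>
      (\<sigma>\<^sub>0 < 0 \<longrightarrow>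
        (x < \<sigma>\<^sub>0 / 2 * t - l \<and> t < - 4 * l / \<sigma>\<^sub>0 \<longrightarrow> has_limit 0) \<and>
        (\<sigma>\<^sub>0 / 2 * t - l < x \<and> x < \<sigma>\<^sub>0 * t + l \<and> t < - 4 * l / \<sigma>\<^sub>0 \<longrightarrow> has_limit (u0 j)) \<and>
        (\<sigma>\<^sub>0 * t + l < x \<and> x < l \<and> t < - 4 * l / \<sigma>\<^sub>0 \<longrightarrow>
           has_limit (u0 j / \<sigma>\<^sub>0 * ((x - l) / t))) \<and>
        (x < l - sqrt (- 4 * l * \<sigma>\<^sub>0 * t) \<and> t > - 4 * l / \<sigma>\<^sub>0 \<longrightarrow> has_limit 0) \<and>
        (l - sqrt (- 4 * l * \<sigma>\<^sub>0 * t) < x \<and> x < l \<and> t > - 4 * l / \<sigma>\<^sub>0 \<longrightarrow>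
           has_limit (u0 j / \<sigma>\<^sub>0 * ((x - l) / t))) \<and>
        (x > l \<longrightarrow> has_limit 0)) \<and>
      (\<sigma>\<^sub>0 > 0 \<longrightarrow>
        (x > \<sigma>\<^sub>0 / 2 * t + l \<and> t < 4 * l / \<sigma>\<^sub>0 \<longrightarrow> has_limit 0) \<and>
        (\<sigma>\<^sub>0 * t - l < x \<and> x < \<sigma>\<^sub>0 / 2 * t + l \<and> t < 4 * l / \<sigma>\<^sub>0 \<longrightarrow> has_limit (u0 j)) \<and>
        (- l < x \<and> x < \<sigma>\<^sub>0 * t - l \<and> t < 4 * l / \<sigma>\<^sub>0 \<longrightarrow>
           has_limit (u0 j / \<sigma>\<^sub>0 * ((x + l) / t))) \<and>
        (x > - l + sqrt (4 * l * \<sigma>\<^sub>0 * t) \<and> t > 4 * l / \<sigma>\<^sub>0 \<longrightarrow> has_limit 0) \<and>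
        (- l < x \<and> x < - l + sqrt (4 * l * \<sigma>\<^sub>0 * t) \<and> t > 4 * l / \<sigma>\<^sub>0 \<longrightarrow>
           has_limit (u0 j / \<sigma>\<^sub>0 * ((x + l) / t))) \<and>
        (x < - l \<longrightarrow> has_limit 0))"
    unfolding Let_def
    by (intro conjI impI; (elim conjE)?; rule lim, (rule neg pos; (simp; fail)), simp)
qed

end
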